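(* Let $Q(x,y)$ be a positive definite real binary quadratic form such that for all integers $x,y$ the value $Q(x,y)$ is a sum of two integer squares (i.e. $Q(x,y)=m^2+n^2$ for some $m,n\in\mathbb{Z}$). Then the determinant of $Q$ is the square of an integer.
   Context: The determinant of a binary quadratic form $Q$ is $\det B$, where $B$ is the real symmetric $2\times 2$ matrix with $Q(v)=\langle Bv,v\rangle$ for all $v\in\mathbb{R}^2$. The integer $0$ is allowed as one of the squares. *)

theory Defs
  imports "HOL-Analysis.Analysis"
begin

definition gram_matrix :: "(real^2 \<Rightarrow> real) \<Rightarrow> real^2^2 \<Rightarrow> bool" where
  "gram_matrix Q B \<longleftrightarrow> transpose B = B \<and> (\<forall>v. Q v = (B *v v) \<bullet> v)"

definition binary_quadratic_form :: "(real^2 \<Rightarrow> real) \<Rightarrow> bool" where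
  "binary_quadratic_form Q \<longleftrightarrow> (\<exists>B. gram_matrix Q B)"

definition positive_definite :: "(real^2 \<Rightarrow> real) \<Rightarrow> bool" where
  "positive_definite Q \<longleftrightarrow> (\<forall>v. v \<noteq> 0 \<longrightarrow> Q v > 0)"

text \<open>The description below is well defined for every quadratic form, by
  \<open>gram_matrix_unique\<close>; it is only meaningful under \<^const>\<open>binary_quadratic_form\<close>.\<close>

definition form_det :: "(real^2 \<Rightarrow> real) \<Rightarrow> real" where
  "form_det Q = det (THE B. gram_matrix Q B)"

lemma gram_matrix_unique:
  assumes "gram_matrix Q A" "gram_matrix Q B"
  shows "A = B"
proof -
  have eq: "(A *v v) \<bullet> v = (B *v v) \<bullet> v" for v
    using assms by (simp add: gram_matrix_def)
  have sym: "C $ 1 $ 2 = C $ 2 $ 1" if "gram_matrix Q C" for C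
  proof -
    have "transpose C $ 1 $ 2 = C $ 1 $ 2"
      using that by (simp add: gram_matrix_def)
    then show ?thesis
      by (simp add: transpose_def)
  qed
  show ?thesis
    using eq[of "vector [1, 0]"] eq[of "vector [0, 1]"] eq[of "vector [1, 1]"]
      sym[OF assms(1)] sym[OF assms(2)]
    by (simp add: vec_eq_iff forall_2 matrix_vector_mult_def inner_vec_def sum_2)
qed

lemma form_det_eq:
  assumes "gram_matrix Q B"
  shows "form_det Q = det B"
proof -
  have "(THE C. gram_matrix Q C) = B"
    using assms by (rule the_equality) (rule gram_matrix_unique[OF _ assms])
  then show ?thesis
    by (simp add: form_det_def)
qed

end

theory Submission
  imports Defs "HOL-Number_Theory.Quadratic_Reciprocity" "HOL-Computational_Algebra.Nth_Powers"
begin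

text \<open>
  The values at $(1,0)$, $(0,1)$ and $(1,1)$ show that $Q = ax^2 + bxy + cy^2$ has integer
  coefficients, so the determinant is $D/4$ with $D = 4ac - b^2 > 0$ an integer. The heart of the
  matter is that $D$ is a square.

  If a prime $p \equiv 3 \pmod 4$ does not divide $D$ and $-D$ is a square modulo $p$, then
  $Q(x,1)$ has a simple zero modulo $p$, and moving $x$ by $p$ if necessary gives a value divisible
  by $p$ exactly once. Such a value is not a sum of two squares
  (\<open>sum_of_two_squares_form_nonresidue\<close>). It remains to find such a prime for every $D > 0$ that is
  not a square (\<open>residue_prime_3_mod_4\<close>). Powers of $4$ may be removed from $D$. If then
  $D \equiv 2$ or $3 \pmod 4$, a prime factor of $1 + D$ or $4 + D$ will do. For
  $D \equiv 1 \pmod 4$, quadratic reciprocity translates the condition into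
  $\chi(p) = -1$ and $f(p) = -1$, where $\chi$ is the nontrivial character modulo $4$ and $f$ is the
  Jacobi symbol $n \mapsto (n/D)$. Both are quadratic characters modulo $4D$, and $f$
  takes the value $-1$ because $D$ is not a square.

  That two such characters $f$, $g$ take the value $-1$ at a common prime
  (\<open>quadratic_characters_both_minus_one\<close>) is the only analytic step. Otherwise their Dirichlet
  convolution $h$ is nonnegative, and at least $1$ at all squares prime to the modulus, so that
  $\sum h(n) x^n$ tends to infinity as $x \to 1^-$. But this series equals
  $\sum_a f(a) G(x^a)$ with $G(y) = \sum_b g(b) y^b$. As $g$ is periodic with mean zero, $G$ is a
  rational function without a pole on $[0,1]$, hence Lipschitz there, so $a \mapsto G(x^a)$ has
  variation bounded independently of $x$; as the partial sums of $f$ are bounded as well, the series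
  stays bounded (\<open>double_series_bounded\<close>).

  Once $D = s^2$, the equation $4ac = b^2 + s^2$ forces $s$ to be even, and the determinant is
  $(s/2)^2$.
\<close>

section \<open>Double series of periodic functions with mean zero\<close>

definition zero_mean_periodic :: "nat \<Rightarrow> (nat \<Rightarrow> real) \<Rightarrow> bool" where
  "zero_mean_periodic M f \<longleftrightarrow>
     M > 0 \<and> (\<forall>n. f (n + M) = f n) \<and> (\<forall>n. \<bar>f n\<bar> \<le> 1) \<and> (\<Sum>n<M. f n) = 0"

lemma zero_mean_periodic_Suc:
  assumes "zero_mean_periodic M f"
  shows "zero_mean_periodic M (\<lambda>n. f (Suc n))"
proof -
  have "f M = f 0"
    using assms unfolding zero_mean_periodic_def by (metis add_0)
  hence "(\<Sum>n<M. f (Suc n)) = (\<Sum>n<M. f n)"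
    using sum.lessThan_Suc_shift[of f M] by simp
  thus ?thesis
    using assms unfolding zero_mean_periodic_def by (metis add_Suc)
qed

text \<open>Full periods cancel, so only an initial segment of fewer than $M$ terms counts.\<close>
lemma zero_mean_periodic_partial_sum_bound:
  assumes "zero_mean_periodic M f"
  shows "\<bar>\<Sum>n<N. f n\<bar> \<le> M"
proof (induction N rule: less_induct)
  case (less N)
  show ?case
  proof (cases "N < M")
    case True
    have "\<bar>\<Sum>n<N. f n\<bar> \<le> (\<Sum>n<N. \<bar>f n\<bar>)" by (rule sum_abs)
    also have "\<dots> \<le> (\<Sum>n<N. 1)"
      using assms by (intro sum_mono) (auto simp: zero_mean_periodic_def)
    finally show ?thesis using True by simp
  next
    case False
    have shift: "(\<Sum>n<K + M. f n) = (\<Sum>n<K. f n)" for K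
      using assms by (induction K) (auto simp: zero_mean_periodic_def)
    have "M > 0" using assms by (simp add: zero_mean_periodic_def)
    thus ?thesis using less[of "N - M"] shift[of "N - M"] False by simp
  qed
qed

text \<open>Summing over one period gives $(1 - y^M)\, G(y) = P(y)$ with a polynomial $P$. The mean being zero
  says $P(1) = 0$, so a factor $1 - y$ cancels; what is left of $1 - y^M$ is $1 + y + \dots + y^{M-1}$.\<close>
lemma power_series_of_zero_mean_periodic:
  assumes "zero_mean_periodic M f"
  shows "\<exists>R U :: real poly. (\<forall>y\<in>{0..1}. poly U y \<noteq> 0) \<and>
           (\<forall>y\<in>{0..<1}. (\<lambda>n. f n * y ^ n) sums (poly R y / poly U y))"
proof -
  have M: "M > 0" and per: "\<And>n. f (n + M) = f n" and bd: "\<And>n. \<bar>f n\<bar> \<le> 1"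
    and zero: "(\<Sum>n<M. f n) = 0"
    using assms by (auto simp: zero_mean_periodic_def)
  define P where "P = (\<Sum>n<M. Polynomial.monom (f n) n)"
  define U where "U = (\<Sum>n<M. Polynomial.monom (1 :: real) n)"
  have polyP: "poly P y = (\<Sum>n<M. f n * y ^ n)" for y
    by (simp add: P_def poly_sum poly_monom)
  have polyU: "poly U y = (\<Sum>n<M. y ^ n)" for y
    by (simp add: U_def poly_sum poly_monom)
  have "poly P 1 = 0" using zero by (simp add: polyP)
  then obtain R where R: "P = [:-1, 1:] * R"
    by (metis poly_eq_0_iff_dvd dvdE)
  have Upos: "poly U y \<ge> 1" if "0 \<le> y" for y
  proof -
    have "(\<Sum>n\<in>{0}. y ^ n) \<le> (\<Sum>n<M. y ^ n)"
      using that M by (intro sum_mono2) auto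
    thus ?thesis by (simp add: polyU)
  qed
  have "(\<lambda>n. f n * y ^ n) sums (poly (- R) y / poly U y)" if y: "0 \<le> y" "y < 1" for y
  proof -
    have "summable (\<lambda>n. norm (y ^ n))" using y by (simp add: summable_geometric)
    hence sm: "summable (\<lambda>n. f n * y ^ n)"
      by (rule summable_comparison_test'[of _ 0])
         (use bd y in \<open>auto simp: abs_mult intro!: mult_left_le_one_le\<close>)
    define G where "G = (\<Sum>n. f n * y ^ n)"
    have "G = (\<Sum>n. f (n + M) * y ^ (n + M)) + poly P y"
      unfolding G_def polyP by (rule suminf_split_initial_segment[OF sm])
    also have "(\<lambda>n. f (n + M) * y ^ (n + M)) = (\<lambda>n. y ^ M * (f n * y ^ n))"
      by (simp add: per power_add algebra_simps)
    also have "suminf \<dots> = y ^ M * G"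
      unfolding G_def by (rule suminf_mult[OF sm])
    finally have "(1 - y ^ M) * G = poly P y" by (simp add: algebra_simps)
    moreover have "1 - y ^ M = (1 - y) * poly U y"
      unfolding polyU by (rule one_diff_power_eq)
    moreover have "poly P y = (1 - y) * poly (- R) y" by (simp add: R algebra_simps)
    ultimately have "(1 - y) * (poly U y * G) = (1 - y) * poly (- R) y"
      by (simp only: mult.assoc)
    hence "poly U y * G = poly (- R) y"
      by (rule mult_left_cancel[THEN iffD1, rotated]) (use y in simp)
    hence "G = poly (- R) y / poly U y"
      using Upos[OF y(1)] by (simp add: field_simps)
    thus ?thesis using summable_sums[OF sm] unfolding G_def by (simp only:)
  qed
  moreover have "poly U y \<noteq> 0" if "0 \<le> y" for y using Upos[OF that] by auto
  ultimately show ?thesis by (intro exI[of _ "- R"] exI[of _ U]) auto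
qed

text \<open>The rational function of \<open>power_series_of_zero_mean_periodic\<close> is continuously differentiable on
  the compact interval $[0,1]$. The bounds hold up to $y = 1$ although the series itself need not
  converge there; this uniformity is what \<open>double_series_bounded\<close> rests on.\<close>
lemma power_series_of_zero_mean_periodic_Lipschitz:
  assumes "zero_mean_periodic M f"
  shows "\<exists>G B L. (\<forall>y\<in>{0..<1}. (\<lambda>n. f n * y ^ n) sums G y \<and> \<bar>G y\<bar> \<le> B) \<and>
           (\<forall>x\<in>{0..<1}. \<forall>y\<in>{x..<1}. \<bar>G x - G y\<bar> \<le> L * (y - x))"
proof -
  obtain R U :: "real poly"
    where U: "\<forall>y\<in>{0..1}. poly U y \<noteq> 0"
      and sums: "\<forall>y\<in>{0..<1}. (\<lambda>n. f n * y ^ n) sums (poly R y / poly U y)"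
    using power_series_of_zero_mean_periodic[OF assms] by blast
  define G where "G = (\<lambda>y. poly R y / poly U y)"
  define G' where "G' = (\<lambda>y. (poly (pderiv R) y * poly U y - poly R y * poly (pderiv U) y)
                            / (poly U y * poly U y))"
  have deriv: "(G has_field_derivative G' y) (at y within {0..1})" if "y \<in> {0..1}" for y
    unfolding G_def G'_def using that U
    by (intro DERIV_divide has_field_derivative_at_within[OF poly_DERIV]) auto
  have "continuous_on {0..1} G" "continuous_on {0..1} G'"
    unfolding G_def G'_def using U by (auto intro!: continuous_intros)
  hence "bounded (G ` {0..1})" "bounded (G' ` {0..1})"
    by (auto intro!: compact_imp_bounded compact_continuous_image)
  then obtain B L where B: "\<And>y. y \<in> {0..1} \<Longrightarrow> \<bar>G y\<bar> \<le> B" and L: "\<And>y. y \<in> {0..1} \<Longrightarrow> \<bar>G' y\<bar> \<le> L"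
    unfolding bounded_iff by (metis imageI real_norm_def)
  have "\<bar>G x - G y\<bar> \<le> L * (y - x)" if "x \<in> {0..<1}" "y \<in> {x..<1}" for x y
    using field_differentiable_bound[of "{0..1}" G G' L x y, OF _ deriv] L that by auto
  thus ?thesis
    using sums B by (intro exI[of _ G] exI[of _ B] exI[of _ L]) (auto simp: G_def)
qed

lemma summation_by_parts:
  fixes f u :: "nat \<Rightarrow> real"
  shows "(\<Sum>i<n. f i * u i) =
           (\<Sum>i<n. f i) * u n + (\<Sum>i<n. (\<Sum>k<Suc i. f k) * (u i - u (Suc i)))"
  by (induction n) (auto simp: algebra_simps)

text \<open>The sum over $b$ is $G(x^a)$ up to the shift of indices, and Abel summation over $a$ uses only the
  bounded partial sums of $f$ and the bounded variation of $a \mapsto G(x^a)$: the differences are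
  dominated by a constant times $x^a - x^{a+1}$, which telescopes. The constant $C$ therefore does not
  depend on $x$.\<close>
lemma double_series_bounded:
  fixes f g :: "nat \<Rightarrow> real"
  assumes f: "zero_mean_periodic M f" and g: "zero_mean_periodic M g"
  shows "\<exists>C. \<forall>x\<in>{0<..<1}. \<exists>S\<le>C.
    ((\<lambda>(a, b). f (Suc a) * g (Suc b) * x ^ (Suc a * Suc b)) has_sum S) UNIV"
proof -
  define f1 g1 where "f1 = (\<lambda>n. f (Suc n))" and "g1 = (\<lambda>n. g (Suc n))"
  have f1: "zero_mean_periodic M f1" and g1: "zero_mean_periodic M g1"
    unfolding f1_def g1_def using f g by (simp_all add: zero_mean_periodic_Suc)
  have f1_le: "\<bar>f1 n\<bar> \<le> 1" and g1_le: "\<bar>g1 n\<bar> \<le> 1" for n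
    using f1 g1 by (auto simp: zero_mean_periodic_def)
  obtain G B L
    where G: "\<forall>y\<in>{0..<1}. (\<lambda>n. g1 n * y ^ n) sums G y \<and> \<bar>G y\<bar> \<le> B"
      and G_diff: "\<forall>x\<in>{0..<1}. \<forall>y\<in>{x..<1}. \<bar>G x - G y\<bar> \<le> L * (y - x)"
    using power_series_of_zero_mean_periodic_Lipschitz[OF g1] by blast
  have sums: "\<And>y. 0 \<le> y \<Longrightarrow> y < 1 \<Longrightarrow> (\<lambda>n. g1 n * y ^ n) sums G y"
    and B: "\<And>y. 0 \<le> y \<Longrightarrow> y < 1 \<Longrightarrow> \<bar>G y\<bar> \<le> B"
    and L: "\<And>x y. 0 \<le> x \<Longrightarrow> x \<le> y \<Longrightarrow> y < 1 \<Longrightarrow> \<bar>G x - G y\<bar> \<le> L * (y - x)"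
    using G G_diff by auto
  have B0: "B \<ge> 0" using B[of 0] by simp
  have L0: "L \<ge> 0" using order_trans[OF abs_ge_zero L[of 0 "1/2"]] by simp
  define C where "C = M * B + M * (L + B)"
  have "\<exists>S\<le>C. ((\<lambda>(a, b). f (Suc a) * g (Suc b) * x ^ (Suc a * Suc b)) has_sum S) UNIV"
    if x: "0 < x" "x < 1" for x
  proof -
    define F where "F = (\<lambda>(a, b). f1 a * g1 b * x ^ (Suc a * Suc b))"
    have "(\<lambda>a. x ^ a) summable_on UNIV"
      using x by (intro norm_summable_imp_summable_on) (simp add: summable_geometric)
    hence "(\<lambda>(a, b). x ^ a * x ^ b) summable_on UNIV \<times> UNIV"
      using x by (intro summable_on_SigmaI[where g = "\<lambda>a. x ^ a * (\<Sum>\<^sub>\<infinity>b. x ^ b)"])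
        (auto intro!: has_sum_cmult_right summable_on_cmult_left)
    hence "(\<lambda>p. norm (case p of (a, b) \<Rightarrow> x ^ a * x ^ b)) summable_on UNIV"
      using x by (simp add: case_prod_unfold)
    \<comment> \<open>As $(a+1)(b+1) \<ge> a + b$, a product of two geometric series dominates.\<close>
    hence "(\<lambda>p. norm (F p)) summable_on UNIV"
    proof (rule Infinite_Sum.abs_summable_on_comparison_test)
      fix p :: "nat \<times> nat"
      obtain a b where p: "p = (a, b)" by (cases p)
      have "\<bar>f1 a\<bar> * \<bar>g1 b\<bar> * x ^ (Suc a * Suc b) \<le> 1 * 1 * x ^ (a + b)"
        using f1_le[of a] g1_le[of b] x by (intro mult_mono power_decreasing) auto
      thus "norm (F p) \<le> norm (case p of (a, b) \<Rightarrow> x ^ a * x ^ b)"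
        using x by (simp add: p F_def abs_mult power_add)
    qed
    hence "F summable_on UNIV" by (rule Infinite_Sum.abs_summable_summable)
    then obtain S where S: "(F has_sum S) UNIV" by (auto simp: summable_on_def)
    define u where "u = (\<lambda>a. x ^ Suc a * G (x ^ Suc a))"
    have pow: "0 < x ^ Suc a" "x ^ Suc a < 1" for a
      using x power_Suc_less_one[of x a] by (simp_all del: power_Suc)
    have row: "((\<lambda>b. F (a, b)) has_sum (f1 a * u a)) UNIV" for a
    proof -
      define y where "y = x ^ Suc a"
      have y: "0 \<le> y" "y < 1" unfolding y_def using pow[of a] by auto
      have "summable (\<lambda>n. norm (y ^ n))" using y by (simp add: summable_geometric)
      hence "summable (\<lambda>n. norm (g1 n * y ^ n))"
        by (rule summable_comparison_test'[of _ 0])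
           (use g1_le y in \<open>auto simp: abs_mult intro!: mult_left_le_one_le\<close>)
      hence "((\<lambda>n. g1 n * y ^ n) has_sum G y) UNIV"
        by (rule norm_summable_imp_has_sum) (rule sums[OF y])
      hence "((\<lambda>n. (f1 a * y) * (g1 n * y ^ n)) has_sum ((f1 a * y) * G y)) UNIV"
        by (rule has_sum_cmult_right)
      moreover have "(f1 a * y) * (g1 n * y ^ n) = F (a, n)" for n
        by (simp only: F_def y_def case_prod_conv power_mult power_Suc mult_ac)
      ultimately show ?thesis by (simp add: u_def y_def mult_ac)
    qed
    have "((\<lambda>a. f1 a * u a) has_sum S) UNIV"
      by (rule has_sum_SigmaD[where f = F and B = "\<lambda>_. UNIV"]) (use S row in auto)
    hence lim: "(\<lambda>n. \<Sum>a<n. f1 a * u a) \<longlonglongrightarrow> S"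
      using has_sum_imp_sums sums_def by blast
    have du: "\<bar>u a - u (Suc a)\<bar> \<le> (L + B) * (x ^ a - x ^ Suc a)" for a
    proof -
      define y z where "y = x ^ Suc (Suc a)" and "z = x ^ Suc a"
      have yz: "0 \<le> y" "y \<le> z" "z < 1"
        unfolding y_def z_def using x pow[of a] by (auto simp: mult_left_le_one_le)
      have "u a - u (Suc a) = z * (G z - G y) + (z - y) * G y"
        by (simp only: u_def y_def z_def) (simp add: algebra_simps)
      hence "\<bar>u a - u (Suc a)\<bar> \<le> \<bar>z\<bar> * \<bar>G y - G z\<bar> + \<bar>z - y\<bar> * \<bar>G y\<bar>"
        by (metis abs_minus_commute abs_mult abs_triangle_ineq)
      also have "\<dots> \<le> 1 * (L * (z - y)) + (z - y) * B"
        using yz B[of y] L[of y z] L0 by (intro add_mono mult_mono) auto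
      also have "\<dots> = (L + B) * (z - y)" by (simp add: algebra_simps)
      also have "\<dots> \<le> (L + B) * (x ^ a - x ^ Suc a)"
      proof (rule mult_left_mono)
        have "x * (x ^ a - x ^ Suc a) \<le> x ^ a - x ^ Suc a"
          using x by (intro mult_left_le_one_le) (auto simp: mult_left_le_one_le)
        thus "z - y \<le> x ^ a - x ^ Suc a" by (simp add: y_def z_def algebra_simps)
      qed (use L0 B0 in auto)
      finally show ?thesis .
    qed
    have "(\<Sum>a<n. f1 a * u a) \<le> C" for n
    proof -
      note Fn = zero_mean_periodic_partial_sum_bound[OF f1]
      have "\<bar>\<Sum>a<n. f1 a * u a\<bar> \<le> \<bar>(\<Sum>i<n. f1 i) * u n\<bar>
              + \<bar>\<Sum>i<n. (\<Sum>k<Suc i. f1 k) * (u i - u (Suc i))\<bar>"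
        by (subst summation_by_parts) (rule abs_triangle_ineq)
      also have "\<dots> \<le> \<bar>(\<Sum>i<n. f1 i) * u n\<bar>
              + (\<Sum>i<n. \<bar>(\<Sum>k<Suc i. f1 k) * (u i - u (Suc i))\<bar>)"
        by (intro add_left_mono sum_abs)
      also have "\<dots> \<le> M * B + (\<Sum>i<n. M * ((L + B) * (x ^ i - x ^ Suc i)))"
      proof (intro add_mono sum_mono)
        have "\<bar>u n\<bar> \<le> 1 * B"
          unfolding u_def abs_mult using pow[of n] B[of "x ^ Suc n"] B0
          by (intro mult_mono) (auto simp: abs_mult)
        thus "\<bar>(\<Sum>i<n. f1 i) * u n\<bar> \<le> M * B"
          unfolding abs_mult using Fn[of n] by (intro mult_mono) auto
        show "\<bar>(\<Sum>k<Suc i. f1 k) * (u i - u (Suc i))\<bar> \<le> M * ((L + B) * (x ^ i - x ^ Suc i))" for i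
          unfolding abs_mult by (intro mult_mono Fn du) auto
      qed
      also have "(\<Sum>i<n. M * ((L + B) * (x ^ i - x ^ Suc i))) = M * ((L + B) * (1 - x ^ n))"
        by (induction n) (auto simp: algebra_simps)
      also have "\<dots> \<le> M * ((L + B) * 1)"
        using x L0 B0 by (intro mult_left_mono) auto
      finally show ?thesis unfolding C_def by simp
    qed
    hence "S \<le> C" by (intro LIMSEQ_le_const2[OF lim]) auto
    thus ?thesis using S unfolding F_def f1_def g1_def by blast
  qed
  thus ?thesis by (intro exI[of _ C]) auto
qed

section \<open>Quadratic characters and their Dirichlet convolution\<close>

definition quadratic_character :: "nat \<Rightarrow> (nat \<Rightarrow> int) \<Rightarrow> bool" where
  "quadratic_character M f \<longleftrightarrow>
     M > 0 \<and> f 1 = 1 \<and> (\<forall>a b. f (a * b) = f a * f b) \<and> (\<forall>n. f (n + M) = f n) \<and>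
     (\<forall>n. f n \<in> {-1, 0, 1}) \<and> (\<forall>n. f n = 0 \<longleftrightarrow> \<not> coprime n M)"

lemma quadratic_character_mod:
  assumes "quadratic_character M f"
  shows "f (n mod M) = f n"
proof -
  have per: "f (n + M) = f n" for n using assms by (simp add: quadratic_character_def)
  have "f (r + M * k) = f r" for r k
  proof (induction k)
    case (Suc k)
    thus ?case using per[of "r + M * k"] by (simp add: algebra_simps)
  qed simp
  from this[of "n mod M" "n div M"] show ?thesis by simp
qed

lemma quadratic_character_power:
  assumes "quadratic_character M f"
  shows "f (a ^ k) = f a ^ k"
  using assms by (induction k) (auto simp: quadratic_character_def)

text \<open>Multiplication by $r$ permutes the residues modulo $M$ and changes the sign of $f$.\<close>
lemma quadratic_character_zero_mean:
  assumes f: "quadratic_character M f" and r: "f r = -1"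
  shows "zero_mean_periodic M (\<lambda>n. of_int (f n))"
proof -
  have M: "M > 0" and mult: "\<And>a b. f (a * b) = f a * f b"
    and vals: "\<And>n. f n \<in> {-1, 0, 1}" and per: "\<And>n. f (n + M) = f n"
    using f by (auto simp: quadratic_character_def)
  have "coprime r M" using f r by (metis quadratic_character_def zero_neq_neg_one)
  have inj: "inj_on (\<lambda>n. r * n mod M) {..<M}"
  proof (rule inj_onI)
    fix a b assume "a \<in> {..<M}" "b \<in> {..<M}" "r * a mod M = r * b mod M"
    thus "a = b"
      using \<open>coprime r M\<close> cong_mult_lcancel_nat[of r M a b] by (simp add: cong_def)
  qed
  have "(\<lambda>n. r * n mod M) ` {..<M} = {..<M}"
    by (rule endo_inj_surj) (use M inj in auto)
  hence "bij_betw (\<lambda>n. r * n mod M) {..<M} {..<M}"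
    using inj by (simp add: bij_betw_def)
  hence "(\<Sum>n<M. f n) = (\<Sum>n<M. f (r * n mod M))"
    by (rule sum.reindex_bij_betw[symmetric])
  also have "\<dots> = (\<Sum>n<M. - f n)"
    by (simp add: quadratic_character_mod[OF f] mult r)
  finally have "(\<Sum>n<M. f n) = 0" by (simp add: sum_negf)
  hence "(\<Sum>n<M. real_of_int (f n)) = 0" by (simp flip: of_int_sum)
  moreover have "\<bar>real_of_int (f n)\<bar> \<le> 1" for n using vals[of n] by auto
  ultimately show ?thesis using M per by (simp add: zero_mean_periodic_def)
qed

definition dirichlet_conv :: "(nat \<Rightarrow> int) \<Rightarrow> (nat \<Rightarrow> int) \<Rightarrow> nat \<Rightarrow> int" where
  "dirichlet_conv f g n = (\<Sum>d | d dvd n. f d * g (n div d))"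

lemma dirichlet_conv_coprime_mult:
  assumes f: "\<And>a b. f (a * b) = f a * f b" and g: "\<And>a b. g (a * b) = g a * g b"
    and "coprime m n" "m > 0" "n > 0"
  shows "dirichlet_conv f g (m * n) = dirichlet_conv f g m * dirichlet_conv f g n"
proof -
  let ?D = "\<lambda>k. {d. d dvd k}"
  have inj: "inj_on (\<lambda>(d, e). d * e) (?D m \<times> ?D n)"
  proof (rule inj_onI, clarsimp)
    fix d e d' e' assume *: "d dvd m" "e dvd n" "d' dvd m" "e' dvd n" "d * e = d' * e'"
    have "coprime d e'" "coprime d' e"
      using * \<open>coprime m n\<close> by (meson coprime_divisors)+
    hence "d dvd d'" "d' dvd d"
      using * by (metis coprime_dvd_mult_left_iff dvd_triv_left)+
    hence "d = d'" by (rule dvd_antisym)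
    moreover have "d > 0" using * \<open>m > 0\<close> by (auto intro: dvd_pos_nat)
    ultimately show "d = d' \<and> e = e'" using * by simp
  qed
  have "(\<lambda>(d, e). d * e) ` (?D m \<times> ?D n) = ?D (m * n)"
    by (auto intro: mult_dvd_mono dest!: division_decomp)
  hence "bij_betw (\<lambda>(d, e). d * e) (?D m \<times> ?D n) (?D (m * n))"
    using inj by (simp add: bij_betw_def)
  hence "dirichlet_conv f g (m * n) =
           (\<Sum>(d, e)\<in>?D m \<times> ?D n. f (d * e) * g (m * n div (d * e)))"
    unfolding dirichlet_conv_def
    by (subst sum.reindex_bij_betw[symmetric]) (auto simp: case_prod_unfold)
  also have "\<dots> = (\<Sum>(d, e)\<in>?D m \<times> ?D n. (f d * g (m div d)) * (f e * g (n div e)))"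
    by (intro sum.cong) (auto simp: f g div_mult_div_if_dvd[symmetric])
  also have "\<dots> = dirichlet_conv f g m * dirichlet_conv f g n"
    by (simp add: dirichlet_conv_def sum_product sum.cartesian_product)
  finally show ?thesis .
qed

lemma dirichlet_conv_prime_power:
  assumes f: "quadratic_character M f" and g: "quadratic_character M g" and p: "prime p"
  shows "dirichlet_conv f g (p ^ k) = (\<Sum>i\<le>k. f p ^ i * g p ^ (k - i))"
proof -
  have "{d. d dvd p ^ k} = (\<lambda>i. p ^ i) ` {..k}"
    using p by (auto simp: divides_primepow_nat)
  moreover have "inj_on (\<lambda>i. p ^ i) {..k}"
    using p prime_gt_1_nat[OF p] by (auto intro!: inj_onI)
  ultimately have "dirichlet_conv f g (p ^ k) = (\<Sum>i\<le>k. f (p ^ i) * g (p ^ k div p ^ i))"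
    by (simp add: dirichlet_conv_def sum.reindex)
  also have "\<dots> = (\<Sum>i\<le>k. f p ^ i * g p ^ (k - i))"
    using p prime_gt_0_nat[OF p]
    by (intro sum.cong) (auto simp: quadratic_character_power[OF f]
        quadratic_character_power[OF g] power_diff[symmetric])
  finally show ?thesis .
qed

lemma sum_alternating_powers: "(\<Sum>i\<le>k. (-1 :: int) ^ i) = (if even k then 1 else 0)"
  by (induction k) auto

text \<open>For $(f(p), g(p))$ equal to $(1, 1)$ the convolution is $k + 1$, for $(1, -1)$ and $(-1, 1)$ it
  alternates between $1$ and $0$. Only $(-1, -1)$ would produce negative values.\<close>
lemma dirichlet_conv_prime_power_bounds:
  assumes f: "quadratic_character M f" and g: "quadratic_character M g" and p: "prime p"
    and not_both: "f p \<noteq> -1 \<or> g p \<noteq> -1"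
  shows "dirichlet_conv f g (p ^ k) \<ge> 0"
    and "coprime p M \<Longrightarrow> even k \<Longrightarrow> dirichlet_conv f g (p ^ k) \<ge> 1"
proof -
  have "(\<Sum>i\<le>k. (-1 :: int) ^ (k - i)) = (\<Sum>i\<le>k. (-1) ^ i)"
    by (rule sum.reindex_bij_witness[of _ "\<lambda>i. k - i" "\<lambda>i. k - i"]) auto
  hence alt: "(\<Sum>i\<le>k. (-1 :: int) ^ (k - i)) = (if even k then 1 else 0)"
    by (simp add: sum_alternating_powers)
  have "f p = 0 \<longleftrightarrow> \<not> coprime p M" "g p = 0 \<longleftrightarrow> \<not> coprime p M"
    "f p \<in> {-1, 0, 1}" "g p \<in> {-1, 0, 1}"
    using f g by (auto simp: quadratic_character_def)
  then consider "f p = 0" "g p = 0" "\<not> coprime p M" | "f p = 1" "g p = 1"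
    | "f p = 1" "g p = -1" | "f p = -1" "g p = 1"
    using not_both by auto
  hence "dirichlet_conv f g (p ^ k) \<ge> 0 \<and>
         (coprime p M \<longrightarrow> even k \<longrightarrow> dirichlet_conv f g (p ^ k) \<ge> 1)"
    unfolding dirichlet_conv_prime_power[OF f g p]
    by cases (auto simp: alt sum_alternating_powers intro!: sum_nonneg)
  thus "dirichlet_conv f g (p ^ k) \<ge> 0"
    and "coprime p M \<Longrightarrow> even k \<Longrightarrow> dirichlet_conv f g (p ^ k) \<ge> 1" by auto
qed

lemma dirichlet_conv_bounds:
  assumes f: "quadratic_character M f" and g: "quadratic_character M g"
    and not_both: "\<And>p. prime p \<Longrightarrow> f p \<noteq> -1 \<or> g p \<noteq> -1"
    and "n > 0"
  shows "dirichlet_conv f g n \<ge> 0"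
    and "coprime n M \<Longrightarrow> dirichlet_conv f g (n\<^sup>2) \<ge> 1"
proof -
  have fm: "\<And>a b. f (a * b) = f a * f b" and gm: "\<And>a b. g (a * b) = g a * g b" and "f 1 = 1" "g 1 = 1"
    using f g by (auto simp: quadratic_character_def)
  have "dirichlet_conv f g n \<ge> 0 \<and> (coprime n M \<longrightarrow> dirichlet_conv f g (n\<^sup>2) \<ge> 1)"
    using \<open>n > 0\<close>
  proof (induction n rule: less_induct)
    case (less n)
    show ?case
    proof (cases "n = 1")
      case True
      thus ?thesis using \<open>f 1 = 1\<close> \<open>g 1 = 1\<close> by (simp add: dirichlet_conv_def)
    next
      case False
      then obtain p where p: "prime p" "p dvd n" using prime_factor_nat by blast
      obtain m where m: "n = p ^ multiplicity p n * m" "\<not> p dvd m"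
        using multiplicity_decompose'[of n p] less.prems not_prime_unit[of p] p by blast
      define k where "k = multiplicity p n"
      have n: "n = p ^ k * m" using m(1) unfolding k_def .
      have "k > 0" using p less.prems unfolding k_def by (simp add: prime_multiplicity_gt_zero_iff)
      have "m > 0" using n less.prems by (auto intro: Nat.gr0I)
      have "1 < p ^ k" using one_less_power[OF prime_gt_1_nat[OF p(1)] \<open>k > 0\<close>] .
      hence "m < n" using n \<open>m > 0\<close> by simp
      have IH: "dirichlet_conv f g m \<ge> 0" "coprime m M \<Longrightarrow> dirichlet_conv f g (m\<^sup>2) \<ge> 1"
        using less.IH[OF \<open>m < n\<close> \<open>m > 0\<close>] by auto
      have "coprime p m" using p(1) m(2) by (simp add: prime_imp_coprime)
      have "p > 0" using p(1) by (simp add: prime_gt_0_nat)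
      have h1: "dirichlet_conv f g n = dirichlet_conv f g (p ^ k) * dirichlet_conv f g m"
        unfolding n by (rule dirichlet_conv_coprime_mult[OF fm gm])
          (use \<open>coprime p m\<close> \<open>m > 0\<close> \<open>p > 0\<close> in auto)
      have "n\<^sup>2 = p ^ (2 * k) * m\<^sup>2"
        by (simp add: n power_mult_distrib power_mult mult.commute)
      hence h2: "dirichlet_conv f g (n\<^sup>2) =
                   dirichlet_conv f g (p ^ (2 * k)) * dirichlet_conv f g (m\<^sup>2)"
        by (simp only:, intro dirichlet_conv_coprime_mult[OF fm gm])
          (use \<open>coprime p m\<close> \<open>m > 0\<close> \<open>p > 0\<close> in auto)
      note pk = dirichlet_conv_prime_power_bounds[OF f g p(1) not_both[OF p(1)]]
      have "dirichlet_conv f g n \<ge> 0" unfolding h1 using pk(1) IH(1) by simp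
      moreover have "dirichlet_conv f g (n\<^sup>2) \<ge> 1" if "coprime n M"
      proof -
        have "coprime p M" "coprime m M"
          using that \<open>k > 0\<close> unfolding n by auto
        hence "dirichlet_conv f g (p ^ (2 * k)) \<ge> 1" "dirichlet_conv f g (m\<^sup>2) \<ge> 1"
          using pk(2) IH(2) by auto
        thus ?thesis unfolding h2 by (metis mult_mono' mult_1 zero_le_one)
      qed
      ultimately show ?thesis by blast
    qed
  qed
  thus "dirichlet_conv f g n \<ge> 0" "coprime n M \<Longrightarrow> dirichlet_conv f g (n\<^sup>2) \<ge> 1" by auto
qed

text \<open>Otherwise the convolution is nonnegative and at least $1$ at the squares of the numbers
  $1 + Mk$. The first $K$ of these contribute at least $\sum_{k<K} x^{(1+Mk)^2}$ to the double series,
  which tends to $K$ as $x \to 1^-$, while the double series is at most $C$ for all $x < 1$.\<close>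
theorem quadratic_characters_both_minus_one:
  assumes f: "quadratic_character M f" and g: "quadratic_character M g"
    and r: "f r = -1" and s: "g s = -1"
  shows "\<exists>p. prime p \<and> f p = -1 \<and> g p = -1"
proof (rule ccontr)
  assume "\<not> ?thesis"
  hence not_both: "\<And>p. prime p \<Longrightarrow> f p \<noteq> -1 \<or> g p \<noteq> -1" by auto
  note bounds = dirichlet_conv_bounds[OF f g not_both]
  let ?h = "dirichlet_conv f g"
  have M: "M > 0" using f by (simp add: quadratic_character_def)
  obtain C where C: "\<forall>x\<in>{0<..<1}. \<exists>S\<le>C. ((\<lambda>(a, b). real_of_int (f (Suc a)) * of_int (g (Suc b))
                       * x ^ (Suc a * Suc b)) has_sum S) UNIV"
    using double_series_bounded[OF quadratic_character_zero_mean[OF f r]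
        quadratic_character_zero_mean[OF g s]] ..
  define sq where "sq = (\<lambda>k. (1 + M * k)\<^sup>2)"
  have "inj sq"
    unfolding sq_def using M by (intro injI) (simp add: power2_eq_iff_nonneg)
  have partial: "(\<Sum>k<K. x ^ sq k) \<le> C" if x: "0 < x" "x < 1" for x :: real and K
  proof -
    define F where "F = (\<lambda>(a, b). real_of_int (f a) * of_int (g b) * x ^ (a * b))"
    have "\<exists>S\<le>C. ((\<lambda>(a, b). F (Suc a, Suc b)) has_sum S) UNIV"
      using bspec[OF C, of x] x
      by (simp only: F_def case_prod_conv greaterThanLessThan_iff simp_thms)
    then obtain S where S: "S \<le> C" and "((\<lambda>(a, b). F (Suc a, Suc b)) has_sum S) UNIV"
      by blast
    \<comment> \<open>Group the pairs by their product $n$, so that the inner sum runs over the divisors of $n$.\<close>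
    moreover have "((\<lambda>(a, b). F (Suc a, Suc b)) has_sum S) UNIV \<longleftrightarrow>
                   ((\<lambda>(n, d). F (d, n div d)) has_sum S) (SIGMA n:{0<..}. {d. d dvd n})"
    proof (rule has_sum_reindex_bij_witness[where
          i = "\<lambda>(n, d). (d - 1, n div d - 1)" and j = "\<lambda>(a, b). (Suc a * Suc b, Suc a)"])
      fix p assume "p \<in> (SIGMA n:{0<..}. {d :: nat. d dvd n})"
      then obtain n d where p: "p = (n, d)" "n > 0" "d dvd n" by auto
      hence "d > 0" "n div d > 0" by (auto intro: dvd_pos_nat simp: dvd_imp_le div_greater_zero_iff)
      thus "(case case p of (n, d) \<Rightarrow> (d - 1, n div d - 1) of (a, b) \<Rightarrow> (Suc a * Suc b, Suc a)) = p"
        using p by (simp del: mult_Suc mult_Suc_right)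
    qed (auto simp del: mult_Suc mult_Suc_right)
    ultimately have Sigma: "((\<lambda>(n, d). F (d, n div d)) has_sum S) (SIGMA n:{0<..}. {d. d dvd n})"
      by blast
    have "((\<lambda>n. of_int (?h n) * x ^ n) has_sum S) {0<..}"
    proof (rule has_sum_SigmaD[OF Sigma], clarsimp)
      fix n :: nat assume "n > 0"
      have "(\<Sum>d | d dvd n. F (d, n div d)) = of_int (?h n) * x ^ n"
        by (simp add: F_def dirichlet_conv_def sum_distrib_right)
      thus "((\<lambda>d. F (d, n div d)) has_sum (of_int (?h n) * x ^ n)) {d. d dvd n}"
        using \<open>n > 0\<close> by (intro has_sum_finiteI) auto
    qed
    hence "(\<Sum>n\<in>sq ` {..<K}. of_int (?h n) * x ^ n) \<le> S"
      by (rule finite_sum_le_has_sum) (use x bounds(1) in \<open>auto simp: sq_def\<close>)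
    also have "(\<Sum>n\<in>sq ` {..<K}. of_int (?h n) * x ^ n) = (\<Sum>k<K. of_int (?h (sq k)) * x ^ sq k)"
      using \<open>inj sq\<close> by (subst sum.reindex) (auto simp: inj_on_def inj_def)
    finally have "(\<Sum>k<K. of_int (?h (sq k)) * x ^ sq k) \<le> S" .
    moreover have "(\<Sum>k<K. 1 * x ^ sq k) \<le> (\<Sum>k<K. of_int (?h (sq k)) * x ^ sq k)"
    proof (intro sum_mono mult_right_mono)
      fix k
      have "coprime (1 + M * k) M"
        by (rule coprimeI) (metis dvd_add_left_iff dvd_mult2)
      thus "1 \<le> real_of_int (?h (sq k))" unfolding sq_def using bounds(2)[of "1 + M * k"] by simp
    qed (use x in auto)
    ultimately show ?thesis using S by simp
  qed
  have "real K \<le> C" for K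
  proof -
    have "((\<lambda>x::real. \<Sum>k<K. x ^ sq k) \<longlongrightarrow> (\<Sum>k<K. 1 ^ sq k)) (at_left 1)"
      by (intro tendsto_intros)
    moreover have "eventually (\<lambda>x::real. (\<Sum>k<K. x ^ sq k) \<le> C) (at_left 1)"
      using eventually_at_left_real[of 0 1] by (rule eventually_mono) (use partial in auto)
    ultimately have "(\<Sum>k<K. 1 ^ sq k) \<le> C"
      by (rule tendsto_upperbound) auto
    thus ?thesis by simp
  qed
  thus False using reals_Archimedean2[of C] by (meson not_le)
qed

section \<open>The Jacobi symbol as a quadratic character\<close>

lemma Legendre_cong:
  assumes "[a = b] (mod p)"
  shows "Legendre a p = Legendre b p"
proof -
  have "[a = 0] (mod p) \<longleftrightarrow> [b = 0] (mod p)" "\<And>y. [y\<^sup>2 = a] (mod p) \<longleftrightarrow> [y\<^sup>2 = b] (mod p)"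
    using assms by (meson cong_sym cong_trans)+
  thus ?thesis by (simp add: Legendre_def QuadRes_def)
qed

lemma Legendre_values: "Legendre a p \<in> {-1, 0, 1}"
  by (simp add: Legendre_def)

lemma Legendre_eq_0_iff: "Legendre a p = 0 \<longleftrightarrow> p dvd a"
  by (simp add: Legendre_def cong_0_iff)

lemma Legendre_eq_1D: "Legendre a p = 1 \<Longrightarrow> QuadRes p a"
  by (auto simp: Legendre_def split: if_splits)

lemma Legendre_1:
  assumes "prime (p :: nat)"
  shows "Legendre 1 p = 1"
proof -
  have "QuadRes p 1" unfolding QuadRes_def by (rule exI[of _ 1]) simp
  moreover have "\<not> int p dvd 1" using prime_gt_1_nat[OF assms] by simp
  ultimately show ?thesis by (simp add: Legendre_def cong_0_iff)
qed

text \<open>Turns the congruence of Euler's criterion into an equality.\<close>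
lemma sign_cong_imp_eq:
  assumes "x \<in> {-1, 0, 1 :: int}" "y \<in> {-1, 0, 1}" "[x = y] (mod int p)" "2 < p"
  shows "x = y"
proof (rule ccontr)
  assume "x \<noteq> y"
  moreover have "int p dvd x - y" using assms(3) by (simp add: cong_iff_dvd_diff)
  ultimately have "int p \<le> \<bar>x - y\<bar>" by (intro zdvd_imp_le) auto
  thus False using assms by auto
qed

lemma Legendre_mult:
  assumes "prime (p :: nat)" "2 < p"
  shows "Legendre (a * b) p = Legendre a p * Legendre b p"
proof (rule sign_cong_imp_eq)
  have "[Legendre (a * b) p = (a * b) ^ ((p - 1) div 2)] (mod p)"
    by (rule euler_criterion[OF assms])
  moreover have "[Legendre a p * Legendre b p = a ^ ((p - 1) div 2) * b ^ ((p - 1) div 2)] (mod p)"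
    by (intro cong_mult euler_criterion[OF assms])
  ultimately show "[Legendre (a * b) p = Legendre a p * Legendre b p] (mod p)"
    by (metis cong_sym cong_trans power_mult_distrib)
  show "Legendre a p * Legendre b p \<in> {-1, 0, 1}"
    using Legendre_values[of a p] Legendre_values[of b p] by auto
qed (use assms Legendre_values in auto)

lemma prime_3_mod_4_gt_2: "prime (p :: nat) \<Longrightarrow> p mod 4 = 3 \<Longrightarrow> 2 < p"
  using prime_ge_2_nat[of p] by (cases "p = 2") auto

lemma Legendre_minus_1:
  assumes "prime (p :: nat)" "p mod 4 = 3"
  shows "Legendre (-1) p = -1"
proof (rule sign_cong_imp_eq)
  have "p > 2" using assms by (rule prime_3_mod_4_gt_2)
  have "odd ((p - 1) div 2)" using assms(2) by presburger
  thus "[Legendre (-1) p = -1] (mod p)"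
    using euler_criterion[OF assms(1) \<open>p > 2\<close>, of "-1"] by simp
  show "2 < p" by fact
qed (use Legendre_values in auto)

lemma odd_prime_gt_2: "prime (p :: nat) \<Longrightarrow> odd p \<Longrightarrow> 2 < p"
  using prime_ge_2_nat[of p] by (cases "p = 2") auto

definition jacobi :: "nat \<Rightarrow> nat \<Rightarrow> int" where
  "jacobi n E = (\<Prod>q\<in>#prime_factorization E. Legendre (int n) (int q))"

lemma odd_prime_factor:
  assumes "odd (E :: nat)" "q \<in># prime_factorization E"
  shows "prime q" "q > 2" "q dvd E" "odd q"
proof -
  show "prime q" and q: "q dvd E" using assms by auto
  show "odd q" using q assms(1) dvd_trans by blast
  thus "q > 2" using \<open>prime q\<close> odd_prime_gt_2 by blast
qed

lemma jacobi_mult: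
  assumes "odd E"
  shows "jacobi (a * b) E = jacobi a E * jacobi b E"
proof -
  have "jacobi (a * b) E = (\<Prod>q\<in>#prime_factorization E. Legendre (int a) (int q) * Legendre (int b) (int q))"
    unfolding jacobi_def
    by (intro arg_cong[where f = prod_mset] image_mset_cong)
       (simp add: Legendre_mult odd_prime_factor[OF assms])
  thus ?thesis by (simp add: jacobi_def prod_mset.distrib)
qed

text \<open>The period $4E$ rather than $E$, and the value $0$ at even arguments, make this a character
  for the same modulus as the character modulo $4$ with which it is paired.\<close>
lemma jacobi_character:
  assumes "odd E"
  shows "quadratic_character (4 * E) (\<lambda>n. if odd n then jacobi n E else 0)"
    (is "quadratic_character _ ?f")
proof -
  have "E > 0" using assms by (rule odd_pos)
  have "jacobi 1 E = (\<Prod>q\<in>#prime_factorization E. 1)"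
    unfolding jacobi_def
    by (intro arg_cong[where f = prod_mset] image_mset_cong)
       (simp add: Legendre_1 odd_prime_factor[OF assms])
  hence one: "jacobi 1 E = 1" by simp
  have per: "jacobi (n + 4 * E) E = jacobi n E" for n
    unfolding jacobi_def
  proof (intro arg_cong[where f = prod_mset] image_mset_cong Legendre_cong)
    fix q assume "q \<in># prime_factorization E"
    hence "int q dvd int (4 * E)" by (simp only: int_dvd_int_iff) auto
    thus "[int (n + 4 * E) = int n] (mod int q)" by (simp add: cong_iff_dvd_diff)
  qed
  have signs: "prod_mset (image_mset h A) \<in> {-1, 0, 1}" if "\<And>q. h q \<in> {-1, 0, 1 :: int}"
    for h and A :: "nat multiset"
  proof (induction A)
    case (add q A)
    thus ?case using that[of q] by auto
  qed simp
  hence vals: "jacobi n E \<in> {-1, 0, 1}" for n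
    unfolding jacobi_def by (intro signs Legendre_values)
  have zero: "jacobi n E = 0 \<longleftrightarrow> \<not> coprime n (4 * E)" if "odd n" for n
  proof -
    have "jacobi n E = 0 \<longleftrightarrow> (\<exists>q. prime q \<and> q dvd E \<and> q dvd n)"
      using \<open>E > 0\<close>
      by (auto simp: jacobi_def prod_mset_zero_iff Legendre_eq_0_iff in_prime_factors_iff)
    also have "\<dots> \<longleftrightarrow> \<not> coprime n E"
    proof
      assume "\<exists>q. prime q \<and> q dvd E \<and> q dvd n"
      thus "\<not> coprime n E" by (meson coprime_common_divisor not_prime_unit)
    next
      assume "\<not> coprime n E"
      hence "gcd n E \<noteq> 1" by (simp only: coprime_iff_gcd_eq_1 not_False_eq_True)
      then obtain q where "prime q" "q dvd gcd n E" using prime_factor_nat by blast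
      thus "\<exists>q. prime q \<and> q dvd E \<and> q dvd n" by auto
    qed
    also have "coprime n E \<longleftrightarrow> coprime n (4 * E)"
      using \<open>odd n\<close> coprime_power_right_iff[of n 2 2] by (simp add: coprime_right_2_iff_odd)
    finally show ?thesis .
  qed
  have "\<not> coprime n (4 * E)" if "even n" for n
    using that coprime_common_divisor_nat[of n "4 * E" 2] by auto
  hence "?f n = 0 \<longleftrightarrow> \<not> coprime n (4 * E)" for n using zero by simp
  moreover have "?f (a * b) = ?f a * ?f b" for a b by (simp add: jacobi_mult[OF assms])
  moreover have "?f (n + 4 * E) = ?f n" for n by (simp add: per del: add_mult_distrib2)
  moreover have "?f n \<in> {-1, 0, 1}" for n using vals by simp
  moreover have "?f 1 = 1" using one by simp
  ultimately show ?thesis using \<open>E > 0\<close> unfolding quadratic_character_def by simp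
qed

lemma character_mod_4:
  assumes "M > 0" "4 dvd M"
  shows "quadratic_character M (\<lambda>n. if coprime n M then if n mod 4 = 1 then 1 else -1 else 0)"
    (is "quadratic_character M ?\<chi>")
proof -
  have mod4: "n mod 4 = 1 \<or> n mod 4 = 3" if "coprime n M" for n
  proof -
    have "2 dvd M" using assms(2) by (rule dvd_trans[rotated]) simp
    hence "odd n" using that coprime_common_divisor_nat[of n M 2] by auto
    thus ?thesis by presburger
  qed
  have "(a * b) mod 4 = 1 \<longleftrightarrow> (a mod 4 = 1 \<longleftrightarrow> b mod 4 = 1)" if "coprime a M" "coprime b M" for a b
    using mod4[OF that(1)] mod4[OF that(2)] by (auto simp: mod_mult_eq[of a 4 b, symmetric])
  hence "?\<chi> (a * b) = ?\<chi> a * ?\<chi> b" for a b by simp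
  moreover have "?\<chi> (n + M) = ?\<chi> n" for n
  proof -
    have "coprime (n + M) M \<longleftrightarrow> coprime n M" by (simp only: coprime_iff_gcd_eq_1 gcd_add1)
    moreover have "(n + M) mod 4 = n mod 4" using assms(2) by (metis mod_add_right_eq dvd_imp_mod_0 add_0_right)
    ultimately show ?thesis by simp
  qed
  moreover have "?\<chi> n \<in> {-1, 0, 1}" "?\<chi> n = 0 \<longleftrightarrow> \<not> coprime n M" "?\<chi> 1 = 1" for n
    by simp_all
  ultimately show ?thesis using assms(1) unfolding quadratic_character_def by blast
qed

lemma Legendre_reciprocity_3_mod_4:
  fixes p q :: nat
  assumes p: "prime p" "p mod 4 = 3" and q: "prime q" "odd q" "q \<noteq> p"
  shows "Legendre q p = Legendre p q * (if q mod 4 = 1 then 1 else -1)"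
proof -
  have "2 < p" "2 < q" using p q by (simp_all add: prime_3_mod_4_gt_2 odd_prime_gt_2)
  have "Legendre p q * Legendre q p = (-1) ^ ((p - 1) div 2 * ((q - 1) div 2))"
    by (rule Quadratic_Reciprocity) (use p q \<open>2 < p\<close> \<open>2 < q\<close> in auto)
  also have "\<dots> = ((-1) ^ ((p - 1) div 2)) ^ ((q - 1) div 2)" by (rule power_mult)
  also have "odd ((p - 1) div 2)" using p(2) by presburger
  hence "(-1 :: int) ^ ((p - 1) div 2) = -1" by simp
  also have "(-1 :: int) ^ ((q - 1) div 2) = (if q mod 4 = 1 then 1 else -1)"
  proof -
    have "even ((q - 1) div 2) \<longleftrightarrow> q mod 4 = 1" using q(2) by presburger
    thus ?thesis by simp
  qed
  finally show ?thesis using Legendre_values[of p q] by (auto split: if_splits)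
qed

text \<open>For $p \equiv 3 \pmod 4$ the sign in the reciprocity law for $p$ and $q$ is the residue of $q$
  modulo $4$, read as $\pm 1$. It is multiplicative in $q$, so the law extends to products; oddness
  of the product is carried along to keep this residue in $\{1, 3\}$.\<close>
lemma Legendre_prod_reciprocity:
  fixes p :: nat and A :: "nat multiset"
  assumes p: "prime p" "p mod 4 = 3"
    and "\<And>q. q \<in># A \<Longrightarrow> prime q \<and> odd q \<and> q \<noteq> p"
  shows "odd (\<Prod>\<^sub># A) \<and>
    Legendre (int (\<Prod>\<^sub># A)) (int p) = (\<Prod>q\<in>#A. Legendre (int p) (int q)) * (if \<Prod>\<^sub># A mod 4 = 1 then 1 else -1)"
  using assms(3)
proof (induction A)
  case empty
  thus ?case using p by (simp add: Legendre_1)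
next
  case (add q A)
  let ?s = "\<lambda>n::nat. if n mod 4 = 1 then 1 else -1 :: int"
  have q: "prime q" "odd q" "q \<noteq> p" using add.prems[of q] by auto
  have IH: "odd (\<Prod>\<^sub># A)" "Legendre (int (\<Prod>\<^sub># A)) p = (\<Prod>q\<in>#A. Legendre (int p) (int q)) * ?s (\<Prod>\<^sub># A)"
    using add by auto
  have "2 < p" using p by (rule prime_3_mod_4_gt_2)
  have "q mod 4 = 1 \<or> q mod 4 = 3" "\<Prod>\<^sub># A mod 4 = 1 \<or> \<Prod>\<^sub># A mod 4 = 3"
    using q(2) IH(1) by presburger+
  hence "?s (q * \<Prod>\<^sub># A) = ?s q * ?s (\<Prod>\<^sub># A)"
    by (auto simp: mod_mult_eq[of q 4 "\<Prod>\<^sub># A", symmetric])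
  thus ?case
    using IH q Legendre_reciprocity_3_mod_4[OF p q]
    by (simp add: Legendre_mult[OF p(1) \<open>2 < p\<close>])
qed

lemma jacobi_reciprocity_3_mod_4:
  fixes p E :: nat
  assumes "prime p" "p mod 4 = 3" "coprime p E" "E mod 4 = 1"
  shows "Legendre E p = jacobi p E"
proof -
  have "odd E" using assms(4) by presburger
  have "q \<noteq> p" if "q dvd E" for q
    using that assms(1,3) coprime_common_divisor_nat[of p E p] by auto
  hence "prime q \<and> odd q \<and> q \<noteq> p" if "q \<in># prime_factorization E" for q
    using odd_prime_factor[OF \<open>odd E\<close> that] by auto
  hence "Legendre (int (\<Prod>\<^sub># (prime_factorization E))) p =
           jacobi p E * (if \<Prod>\<^sub># (prime_factorization E) mod 4 = 1 then 1 else -1)"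
    unfolding jacobi_def using Legendre_prod_reciprocity[OF assms(1,2)] by blast
  thus ?thesis
    using \<open>odd E\<close> odd_pos[OF \<open>odd E\<close>] assms(4) by (simp add: prod_mset_prime_factorization_nat)
qed

text \<open>If every residue were a square, squaring would be a permutation of the residues modulo $q$; but
  $1$ and $q - 1$ have the same square.\<close>
lemma exists_nonresidue:
  assumes "prime q" "2 < (q :: nat)"
  shows "\<exists>r :: nat. Legendre r q = -1"
proof (rule ccontr)
  assume no: "\<not> ?thesis"
  let ?f = "\<lambda>y. y\<^sup>2 mod q"
  have "{..<q} \<subseteq> ?f ` {..<q}"
  proof
    fix r assume r: "r \<in> {..<q}"
    have "QuadRes q r"
    proof (cases "int q dvd r")
      case True
      thus ?thesis unfolding QuadRes_def by (intro exI[of _ 0]) (simp add: cong_iff_dvd_diff)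
    next
      case False
      hence "Legendre r q = 1"
        using no Legendre_values[of r q] by (auto simp: Legendre_eq_0_iff)
      thus ?thesis by (rule Legendre_eq_1D)
    qed
    then obtain y where y: "[y\<^sup>2 = int r] (mod q)" by (auto simp: QuadRes_def)
    define z where "z = nat (y mod q)"
    have z: "int z = y mod q" using assms by (simp add: z_def)
    have "[(int z)\<^sup>2 = int r] (mod q)" using y by (simp add: z cong_def power_mod)
    hence "[z\<^sup>2 = r] (mod q)" by (simp flip: cong_int_iff)
    hence "r = ?f z" using r by (simp add: cong_def)
    moreover have "z < q" using assms z pos_mod_bound[of "int q" y] by linarith
    ultimately show "r \<in> ?f ` {..<q}" by blast
  qed
  hence "inj_on ?f {..<q}"
    by (intro eq_card_imp_inj_on antisym card_image_le card_mono) auto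
  moreover have "?f (q - 1) = ?f 1"
  proof -
    have "(q - 1)\<^sup>2 = 1 + (q - 2) * q"
    proof -
      obtain c where "q = c + 2" using assms(2) by (metis le_add_diff_inverse2 less_imp_le_nat)
      thus ?thesis by (simp add: power2_eq_square algebra_simps)
    qed
    thus ?thesis by (simp only: mod_mult_self1 power_one)
  qed
  ultimately have "q - 1 = 1" by (rule inj_onD) (use assms in auto)
  thus False using assms by simp
qed

text \<open>Take a prime $q$ of odd multiplicity in $E$, and by the Chinese remainder theorem an $r$ that is a
  nonresidue modulo $q$ but $1$ modulo $4$ and modulo the other primes of $E$. Only the factors
  belonging to $q$ contribute to the Jacobi symbol, an odd number of times $-1$.\<close>
lemma jacobi_eq_minus_1:
  assumes "odd E" "\<not> is_square E"
  shows "\<exists>r. odd r \<and> jacobi r E = -1"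
proof -
  obtain q where q: "prime q" "odd (multiplicity q E)"
    using assms(2) is_nth_power_conv_multiplicity_nat[of 2 E] by auto
  have "E > 0" using assms(1) by (rule odd_pos)
  obtain E' where E': "E = q ^ multiplicity q E * E'" "\<not> q dvd E'"
    using multiplicity_decompose'[of E q] \<open>E > 0\<close> not_prime_unit[of q] q(1) by blast
  have "q dvd E" using q(2) by (metis dvd_0_right not_dvd_imp_multiplicity_0)
  hence "q \<in># prime_factorization E"
    using q(1) \<open>E > 0\<close> by (simp add: in_prime_factors_iff)
  note oq = odd_prime_factor[OF assms(1) this]
  obtain t where t: "Legendre (int t) q = -1" using exists_nonresidue[OF oq(1,2)] by blast
  have "coprime q (4 * E')"
    using oq E'(2) coprime_power_right_iff[of q 2 2] by (simp add: prime_imp_coprime coprime_right_2_iff_odd)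
  then obtain r where r: "[r = t] (mod q)" "[r = 1] (mod (4 * E'))"
    using binary_chinese_remainder_nat by blast
  have "[r = 1] (mod 4)" using r(2) by (rule cong_dvd_modulus_nat) simp
  hence "odd r" unfolding cong_def by presburger
  have "Legendre r q = -1"
    using Legendre_cong[of r t q] r(1) t by (simp add: cong_int_iff)
  moreover have "Legendre r l = 1" if "l \<in># prime_factorization E" "l \<noteq> q" for l
  proof -
    have "prime l" "l dvd E" using that by auto
    hence "l dvd E'"
      using that(2) q(1) E'(1) by (metis prime_dvd_mult_iff prime_dvd_power primes_dvd_imp_eq)
    hence "[r = 1] (mod l)" using r(2) by (intro cong_dvd_modulus_nat[OF r(2)]) simp
    hence "Legendre r l = Legendre 1 l" by (intro Legendre_cong) (simp flip: cong_int_iff)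
    thus ?thesis using Legendre_1[OF \<open>prime l\<close>] by simp
  qed
  hence "jacobi r E = (\<Prod>l\<in>prime_factors E. if l = q then Legendre r q ^ multiplicity q E else 1)"
    unfolding jacobi_def image_prod_mset_multiplicity
    by (intro prod.cong) (auto simp: count_prime_factorization)
  ultimately have "jacobi r E = -1"
    using \<open>q \<in># prime_factorization E\<close> q(2) by simp
  thus ?thesis using \<open>odd r\<close> by blast
qed

section \<open>Primes congruent to 3 modulo 4 for which a negative integer is a residue\<close>

text \<open>The character $g$ of the proof singles out $p \equiv 3 \pmod 4$. For such $p$ the number $-1$ is a
  nonresidue, so $-E$ is a residue exactly if $(E/p) = -1$, and $(E/p) = (p/E)$ because
  $E \equiv 1 \pmod 4$.\<close>
lemma residue_prime_1_mod_4:
  fixes E :: nat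
  assumes "E mod 4 = 1" "\<not> is_square E"
  shows "\<exists>p. prime p \<and> p mod 4 = 3 \<and> \<not> p dvd E \<and> QuadRes (int p) (- int E)"
proof -
  have "odd E" using assms(1) by presburger
  hence "E > 0" by (rule odd_pos)
  define f where "f = (\<lambda>n. if odd n then jacobi n E else 0)"
  define g :: "nat \<Rightarrow> int"
    where "g = (\<lambda>n. if coprime n (4 * E) then if n mod 4 = 1 then 1 else -1 else 0)"
  have f: "quadratic_character (4 * E) f"
    unfolding f_def by (rule jacobi_character[OF \<open>odd E\<close>])
  have g: "quadratic_character (4 * E) g"
    unfolding g_def by (rule character_mod_4) (use \<open>E > 0\<close> in auto)
  obtain r where "odd r" "jacobi r E = -1"
    using jacobi_eq_minus_1[OF \<open>odd E\<close> assms(2)] by blast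
  hence r: "f r = -1" by (simp add: f_def)
  \<comment> \<open>The number $4E - 1$ shows that $g$ is nontrivial.\<close>
  have "coprime (4 * E - 1) (4 * E)"
    using coprime_diff_one_left_nat[of "4 * E"] \<open>E > 0\<close> by simp
  moreover have "(4 * E - 1) mod 4 \<noteq> 1"
  proof -
    have "4 * E - 1 = 3 + 4 * (E - 1)" using \<open>E > 0\<close> by linarith
    thus ?thesis by simp
  qed
  ultimately have s: "g (4 * E - 1) = -1" by (simp only: g_def if_True if_False)
  obtain p where p: "prime p" "f p = -1" "g p = -1"
    using quadratic_characters_both_minus_one[OF f g r s] by blast
  have "coprime p (4 * E)" "p mod 4 \<noteq> 1" "odd p" "jacobi p E = -1"
    using p(2,3) unfolding f_def g_def by (simp_all only: not_False_eq_True split: if_splits)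
  hence "p mod 4 = 3" by presburger
  have "coprime p E" using \<open>coprime p (4 * E)\<close> by simp
  have "Legendre (int E) p = -1"
    using jacobi_reciprocity_3_mod_4[OF p(1) \<open>p mod 4 = 3\<close> \<open>coprime p E\<close> assms(1)]
      \<open>jacobi p E = -1\<close> by simp
  hence "Legendre (-1 * int E) p = 1"
    using Legendre_mult[OF p(1) prime_3_mod_4_gt_2[OF p(1) \<open>p mod 4 = 3\<close>], of "-1" "int E"]
      Legendre_minus_1[OF p(1) \<open>p mod 4 = 3\<close>] by simp
  hence "QuadRes p (- int E)" by (intro Legendre_eq_1D) simp
  moreover have "\<not> p dvd E"
    using p(1) \<open>coprime p E\<close> coprime_common_divisor_nat[of p E p] by auto
  ultimately show ?thesis using p(1) \<open>p mod 4 = 3\<close> by blast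
qed

lemma prime_factor_3_mod_4:
  assumes "(n :: nat) mod 4 = 3"
  shows "\<exists>p. prime p \<and> p dvd n \<and> p mod 4 = 3"
  using assms
proof (induction n rule: less_induct)
  case (less n)
  have "n \<noteq> 1" using less.prems by auto
  then obtain p where p: "prime p" "p dvd n" using prime_factor_nat by blast
  then obtain m where n: "n = p * m" by blast
  have "odd (p * m)" using less.prems unfolding n by presburger
  hence "p mod 4 = 1 \<or> p mod 4 = 3" by (simp, presburger)
  thus ?case
  proof
    assume "p mod 4 = 1"
    hence "m mod 4 = 3"
      using less.prems mod_mult_left_eq[of p 4 m] unfolding n by simp
    moreover have "m < n"
      using n prime_gt_1_nat[OF p(1)] \<open>m mod 4 = 3\<close> by (cases "m = 0") auto
    ultimately show ?thesis using less.IH[of m] n by auto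
  qed (use p in auto)
qed

text \<open>A prime factor of $t^2 + E$ has $-E$ as a square residue. If it is $3$ modulo $4$, it is
  odd and does not divide $t$, hence not $E$ either. The lemma is used for $t = 1$ and $t = 2$.\<close>
lemma residue_prime_of_sum:
  fixes E t :: nat
  assumes "(t\<^sup>2 + E) mod 4 = 3" "\<And>p. prime p \<Longrightarrow> p dvd t \<Longrightarrow> p = 2"
  shows "\<exists>p. prime p \<and> p mod 4 = 3 \<and> \<not> p dvd E \<and> QuadRes (int p) (- int E)"
proof -
  obtain p where p: "prime p" "p dvd t\<^sup>2 + E" "p mod 4 = 3"
    using prime_factor_3_mod_4[OF assms(1)] by blast
  have "\<not> p dvd t" using assms(2)[OF p(1)] p(3) by auto
  hence "\<not> p dvd t\<^sup>2" using p(1) prime_dvd_power by blast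
  hence "\<not> p dvd E" using p(2) dvd_add_left_iff by blast
  moreover have "[(int t)\<^sup>2 = - int E] (mod p)"
    using p(2) by (simp add: cong_iff_dvd_diff flip: of_nat_power of_nat_add)
  hence "QuadRes p (- int E)" unfolding QuadRes_def by blast
  ultimately show ?thesis using p by blast
qed

text \<open>Removing a power of $4$ from $D$ changes neither the squareness of $D$ nor the residue symbols at
  odd primes. What remains is not divisible by $4$, which leaves the three classes treated above.\<close>
theorem residue_prime_3_mod_4:
  fixes D :: nat
  assumes "\<not> is_square D"
  shows "\<exists>p. prime p \<and> p mod 4 = 3 \<and> \<not> p dvd D \<and> QuadRes (int p) (- int D)"
proof -
  have "D > 0" using assms by (auto intro: Nat.gr0I)
  obtain E where E: "D = 2 ^ multiplicity 2 D * E" "odd E"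
    using multiplicity_decompose'[of D "2 :: nat"] \<open>D > 0\<close> by auto
  obtain j D0 where D: "D = (2 ^ j)\<^sup>2 * D0" and D0: "odd D0 \<or> D0 = 2 * E"
  proof (cases "even (multiplicity 2 D)")
    case True
    then obtain j where "multiplicity 2 D = 2 * j" by blast
    hence "D = (2 ^ j)\<^sup>2 * E" using E(1) by (simp add: power_mult mult.commute flip: power_mult)
    thus ?thesis using that E(2) by blast
  next
    case False
    then obtain j where "multiplicity 2 D = 2 * j + 1" by (auto elim: oddE)
    hence "D = (2 ^ j)\<^sup>2 * (2 * E)" using E(1) by (simp add: power_mult mult.commute flip: power_mult)
    thus ?thesis using that by blast
  qed
  have "\<not> is_square D0"
    using assms unfolding D by (auto simp: is_nth_power_def simp flip: power_mult_distrib)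
  have "D0 mod 4 = 1 \<or> D0 mod 4 = 2 \<or> D0 mod 4 = 3" using D0 E(2) by presburger
  then consider "D0 mod 4 = 1" | "D0 mod 4 = 2" | "D0 mod 4 = 3" by blast
  hence "\<exists>p. prime p \<and> p mod 4 = 3 \<and> \<not> p dvd D0 \<and> QuadRes (int p) (- int D0)"
  proof cases
    case 1
    thus ?thesis using \<open>\<not> is_square D0\<close> by (rule residue_prime_1_mod_4)
  next
    case 2
    hence "(1\<^sup>2 + D0) mod 4 = 3" by (simp, presburger)
    thus ?thesis by (rule residue_prime_of_sum) auto
  next
    case 3
    hence "(2\<^sup>2 + D0) mod 4 = 3" by simp
    thus ?thesis by (rule residue_prime_of_sum) (auto simp: primes_dvd_imp_eq)
  qed
  then obtain p y where p: "prime p" "p mod 4 = 3" "\<not> p dvd D0"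
    and y: "[y\<^sup>2 = - int D0] (mod int p)" by (auto simp: QuadRes_def)
  have "\<not> p dvd 2" using p(1,2) by (metis prime_3_mod_4_gt_2 dvd_imp_le not_le zero_less_numeral)
  hence "\<not> p dvd (2 ^ j)\<^sup>2" using p(1) by (metis prime_dvd_power)
  hence "\<not> p dvd D" unfolding D using p(1,3) by (simp add: prime_dvd_mult_iff)
  have "[(2 ^ j)\<^sup>2 * y\<^sup>2 = (2 ^ j)\<^sup>2 * (- int D0)] (mod int p)"
    using y by (rule cong_scalar_left)
  hence "[(2 ^ j * y)\<^sup>2 = - int D] (mod int p)" unfolding D by (simp add: power_mult_distrib)
  hence "QuadRes p (- int D)" unfolding QuadRes_def by blast
  thus ?thesis using p(1,2) \<open>\<not> p dvd D\<close> by blast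
qed

section \<open>Binary quadratic forms whose values are sums of two squares\<close>

text \<open>Since $-1$ is a nonresidue modulo $p$, such a $p$ divides both $m$ and $n$.\<close>
lemma prime_square_dvd_sum_of_two_squares:
  fixes p :: nat and m n :: int
  assumes p: "prime p" "p mod 4 = 3" and dvd: "int p dvd m\<^sup>2 + n\<^sup>2"
  shows "(int p)\<^sup>2 dvd m\<^sup>2 + n\<^sup>2"
proof -
  have "p > 2" using p by (rule prime_3_mod_4_gt_2)
  have "int p dvd n"
  proof (rule ccontr)
    assume "\<not> int p dvd n"
    hence "Legendre n p \<noteq> 0" by (simp add: Legendre_eq_0_iff)
    hence "Legendre (-1 * (n * n)) p = -1"
      unfolding Legendre_mult[OF p(1) \<open>p > 2\<close>] Legendre_minus_1[OF p]
      using Legendre_values[of n p] by auto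
    moreover have "[m\<^sup>2 = -1 * (n * n)] (mod p)"
      using dvd by (simp add: cong_iff_dvd_diff power2_eq_square)
    hence "QuadRes p (-1 * (n * n))" unfolding QuadRes_def by blast
    ultimately show False by (auto simp: Legendre_def split: if_splits)
  qed
  hence "int p dvd m\<^sup>2" using dvd by (simp add: dvd_add_left_iff power2_eq_square)
  hence "int p dvd m" using p(1) by (metis prime_dvd_power prime_int_nat_transfer int_eq_iff prime_nat_int_transfer)
  with \<open>int p dvd n\<close> show ?thesis by (intro dvd_add dvd_power_same)
qed

text \<open>Let $F(x) = Q(x,1)$. A zero $x$ of $F$ modulo $p$ is also one modulo $p^2$, and so is $x + p$; hence
  $p$ divides $F'(x) = 2ax + b$, and then also $D = 4a\,F(x) - F'(x)^2$. So $F$ has no zero modulo $p$.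
  If $p$ does not divide $a$, completing the square produces a zero from a square root of $-D$; if $p$
  divides $a$, then $F$ is linear modulo $p$ with leading coefficient $b$, which is invertible since
  $p$ does not divide $D$.\<close>
lemma sum_of_two_squares_form_nonresidue:
  fixes a b c :: int and p :: nat
  assumes form: "\<And>x y. \<exists>m n. a * x\<^sup>2 + b * x * y + c * y\<^sup>2 = m\<^sup>2 + n\<^sup>2"
    and p: "prime p" "p mod 4 = 3" and ndvd: "\<not> int p dvd 4 * a * c - b\<^sup>2"
  shows "\<not> QuadRes p (- (4 * a * c - b\<^sup>2))"
proof
  assume "QuadRes p (- (4 * a * c - b\<^sup>2))"
  then obtain z where z: "int p dvd z\<^sup>2 + (4 * a * c - b\<^sup>2)"
    by (auto simp: QuadRes_def cong_iff_dvd_diff algebra_simps)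
  have prime: "prime (int p)" using p(1) by simp
  have "p > 2" using p by (rule prime_3_mod_4_gt_2)
  define F where "F = (\<lambda>x. a * x\<^sup>2 + b * x + c)"
  have square_dvd: "(int p)\<^sup>2 dvd F x" if "int p dvd F x" for x
    using form[of x 1] prime_square_dvd_sum_of_two_squares[OF p] that by (auto simp: F_def)
  have deriv: "int p dvd 2 * a * x + b" if "int p dvd F x" for x
  proof -
    have diff: "F (x + p) - F x = p * (2 * a * x + b) + a * (int p)\<^sup>2"
      by (simp add: F_def power2_eq_square algebra_simps)
    have "int p dvd F (x + p) - F x" unfolding diff by (simp add: power2_eq_square)
    hence "int p dvd F (x + p)" using that by (metis diff_add_cancel dvd_add)
    hence "(int p)\<^sup>2 dvd F (x + p) - F x" using square_dvd that by (intro dvd_diff) auto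
    hence "(int p)\<^sup>2 dvd p * (2 * a * x + b)" unfolding diff by (simp add: dvd_add_left_iff)
    thus ?thesis using \<open>p > 2\<close> by (simp add: power2_eq_square)
  qed
  have disc: "4 * a * F x = (2 * a * x + b)\<^sup>2 + (4 * a * c - b\<^sup>2)" for x
    by (simp add: F_def power2_eq_square algebra_simps)
  have "\<not> int p dvd F x" for x
  proof
    assume "int p dvd F x"
    hence "int p dvd (2 * a * x + b)\<^sup>2" "int p dvd 4 * a * F x"
      using deriv by (simp_all add: power2_eq_square)
    thus False using ndvd unfolding disc by (simp add: dvd_add_right_iff)
  qed
  moreover have "\<exists>x. int p dvd F x"
  proof (cases "int p dvd a")
    case True
    have "\<not> int p dvd b"
    proof
      assume "int p dvd b"
      with True have "int p dvd 4 * a * c - b\<^sup>2" by (simp add: power2_eq_square)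
      thus False using ndvd by simp
    qed
    hence "coprime b (int p)" using prime_imp_coprime[OF prime] coprime_commute by blast
    then obtain u where "[b * u = 1] (mod int p)" using cong_solve_coprime_int by blast
    hence "[b * u * (- c) = 1 * (- c)] (mod int p)" by (rule cong_scalar_right)
    hence "int p dvd b * (u * (- c)) + c" by (simp add: cong_iff_dvd_diff mult.assoc)
    hence "int p dvd F (u * (- c))"
      unfolding F_def add.assoc
      by (intro dvd_add[OF dvd_mult2[OF True]]) (simp add: mult.assoc)
    thus ?thesis by blast
  next
    case False
    have "\<not> int p dvd 2" using \<open>p > 2\<close> by (auto dest: zdvd_imp_le)
    hence "\<not> int p dvd 2 * a" using False prime by (simp add: prime_dvd_mult_iff)
    hence "coprime (2 * a) (int p)" using prime_imp_coprime[OF prime] coprime_commute by blast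
    then obtain u where u: "[2 * a * u = 1] (mod int p)" using cong_solve_coprime_int by blast
    define x where "x = u * (z - b)"
    have "[2 * a * u * (z - b) = 1 * (z - b)] (mod int p)" using u by (rule cong_scalar_right)
    hence "[2 * a * x + b = z - b + b] (mod int p)"
      unfolding x_def by (intro cong_add) (simp_all add: mult.assoc)
    hence "[(2 * a * x + b)\<^sup>2 + (4 * a * c - b\<^sup>2) = z\<^sup>2 + (4 * a * c - b\<^sup>2)] (mod int p)"
      by (intro cong_add cong_pow) simp_all
    hence "int p dvd 4 * a * F x" using z unfolding disc by (simp add: cong_dvd_iff)
    hence "int p dvd 2 * (2 * a * F x)" by (simp add: mult.assoc)
    hence "int p dvd F x"
      using \<open>\<not> int p dvd 2\<close> \<open>\<not> int p dvd 2 * a\<close> prime prime_dvd_mult_iff by blast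
    thus ?thesis by blast
  qed
  ultimately show False by blast
qed

theorem sum_of_two_squares_form_disc:
  fixes a b c :: int
  assumes form: "\<And>x y. \<exists>m n. a * x\<^sup>2 + b * x * y + c * y\<^sup>2 = m\<^sup>2 + n\<^sup>2"
    and pos: "4 * a * c - b\<^sup>2 > 0"
  shows "\<exists>k. 4 * a * c - b\<^sup>2 = 4 * k\<^sup>2"
proof -
  define D where "D = nat (4 * a * c - b\<^sup>2)"
  have D: "int D = 4 * a * c - b\<^sup>2" using pos by (simp add: D_def)
  have "is_square D"
  proof (rule ccontr)
    assume "\<not> is_square D"
    then obtain p where "prime p" "p mod 4 = 3" "\<not> p dvd D" "QuadRes (int p) (- int D)"
      using residue_prime_3_mod_4 by blast
    thus False
      using sum_of_two_squares_form_nonresidue[OF form, of p] unfolding D[symmetric]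
      by (simp add: int_dvd_int_iff)
  qed
  then obtain s where "D = s\<^sup>2" by (auto elim: is_nth_powerE)
  hence s: "4 * a * c = b\<^sup>2 + (int s)\<^sup>2" using D by simp
  have "even (int s)"
  proof (rule ccontr)
    assume "odd (int s)"
    moreover have "even (b\<^sup>2 + (int s)\<^sup>2)" unfolding s[symmetric] by simp
    ultimately have "odd b" by simp
    then obtain i j where "b = 2 * i + 1" "int s = 2 * j + 1" using \<open>odd (int s)\<close> by (meson oddE)
    \<comment> \<open>Two odd squares add up to $2$ modulo $4$, not to $0$.\<close>
    hence "b\<^sup>2 + (int s)\<^sup>2 = 4 * (i\<^sup>2 + i + j\<^sup>2 + j) + 2"
      by (simp add: power2_eq_square algebra_simps)
    hence "4 * (a * c) = 4 * (i\<^sup>2 + i + j\<^sup>2 + j) + 2" using s by simp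
    thus False by presburger
  qed
  then obtain k where "int s = 2 * k" by blast
  hence "4 * a * c - b\<^sup>2 = 4 * k\<^sup>2" using s by (simp add: power_mult_distrib)
  thus ?thesis by blast
qed

text \<open>Positive definiteness enters only through $D > 0$, which follows from $Q(-b, 2a) = a D$ and
  $a = Q(1,0) > 0$.\<close>
theorem theorem3:
  fixes Q :: "real^2 \<Rightarrow> real"
  assumes "binary_quadratic_form Q"
    and "positive_definite Q"
    and "\<forall>x y :: int. \<exists>m n :: int. Q (vector [of_int x, of_int y]) = of_int (m\<^sup>2 + n\<^sup>2)"
  shows "\<exists>k :: int. form_det Q = of_int (k\<^sup>2)"
proof -
  obtain B where B: "gram_matrix Q B"
    using assms(1) unfolding binary_quadratic_form_def by blast
  define \<alpha> \<beta> \<gamma> where "\<alpha> = B $ 1 $ 1" and "\<beta> = 2 * B $ 1 $ 2" and "\<gamma> = B $ 2 $ 2"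
  have "transpose B $ 1 $ 2 = B $ 1 $ 2" using B by (simp add: gram_matrix_def)
  hence sym: "B $ 2 $ 1 = B $ 1 $ 2" by (simp add: transpose_def)
  have Q: "Q (vector [x, y]) = \<alpha> * x\<^sup>2 + \<beta> * x * y + \<gamma> * y\<^sup>2" for x y
    using B by (simp add: gram_matrix_def matrix_vector_mult_def inner_vec_def sum_2 sym
        \<alpha>_def \<beta>_def \<gamma>_def power2_eq_square algebra_simps)
  have det: "4 * form_det Q = 4 * \<alpha> * \<gamma> - \<beta>\<^sup>2"
    by (simp add: form_det_eq[OF B] det_2 sym \<alpha>_def \<beta>_def \<gamma>_def power2_eq_square)
  have values_int: "\<exists>k :: int. \<alpha> * (of_int x)\<^sup>2 + \<beta> * of_int x * of_int y + \<gamma> * (of_int y)\<^sup>2 = of_int k"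
    for x y :: int
    using assms(3) unfolding Q by blast
  obtain a where a: "\<alpha> = of_int a" using values_int[of 1 0] by auto
  obtain c where c: "\<gamma> = of_int c" using values_int[of 0 1] by auto
  obtain d where "\<alpha> + \<beta> + \<gamma> = of_int d" using values_int[of 1 1] by auto
  hence b: "\<beta> = of_int (d - a - c)" unfolding a c by simp
  define b where "b = d - a - c"
  have form: "\<exists>m n. a * x\<^sup>2 + b * x * y + c * y\<^sup>2 = m\<^sup>2 + n\<^sup>2" for x y :: int
  proof -
    obtain m n :: int where "Q (vector [of_int x, of_int y]) = of_int (m\<^sup>2 + n\<^sup>2)"
      using assms(3) by blast
    hence "real_of_int (a * x\<^sup>2 + b * x * y + c * y\<^sup>2) = of_int (m\<^sup>2 + n\<^sup>2)"
      unfolding Q a b c b_def by simp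
    thus ?thesis unfolding of_int_eq_iff by blast
  qed
  \<comment> \<open>Completing the square: the form takes the value $a D$ at this vector.\<close>
  have "vector [-\<beta>, 2 * \<alpha>] \<noteq> (0 :: real^2)" if "\<alpha> \<noteq> 0"
    using that by (auto simp: vec_eq_iff forall_2)
  moreover have "\<alpha> > 0"
    using assms(2) Q[of 1 0] unfolding positive_definite_def
    by (metis (no_types, lifting) vector_2(1) zero_index zero_neq_one mult_1_right mult_zero_right add_0_right one_power2 zero_power2)
  ultimately have "\<alpha> * (-\<beta>)\<^sup>2 + \<beta> * (-\<beta>) * (2 * \<alpha>) + \<gamma> * (2 * \<alpha>)\<^sup>2 > 0"
    using assms(2) unfolding positive_definite_def Q[symmetric] by simp
  also have "\<alpha> * (-\<beta>)\<^sup>2 + \<beta> * (-\<beta>) * (2 * \<alpha>) + \<gamma> * (2 * \<alpha>)\<^sup>2 = \<alpha> * (4 * \<alpha> * \<gamma> - \<beta>\<^sup>2)"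
    by (simp add: power2_eq_square algebra_simps)
  finally have "4 * \<alpha> * \<gamma> - \<beta>\<^sup>2 > 0" using \<open>\<alpha> > 0\<close> by (simp add: zero_less_mult_iff)
  hence "real_of_int (4 * a * c - b\<^sup>2) > 0" unfolding a b c b_def by simp
  hence "4 * a * c - b\<^sup>2 > 0" by (simp only: of_int_0_less_iff)
  then obtain k where "4 * a * c - b\<^sup>2 = 4 * k\<^sup>2"
    using sum_of_two_squares_form_disc[OF form] by blast
  hence "real_of_int (4 * a * c - b\<^sup>2) = of_int (4 * k\<^sup>2)" by (simp only:)
  hence "4 * form_det Q = 4 * of_int (k\<^sup>2)" unfolding det a b c b_def by simp
  thus ?thesis by auto
qed

end
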